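(* (1) Let $p,d\ge1$ and $w^1,\dots,w^d\in\mathbb{R}^p$. For any fixed $x\in\Delta^p$ and $z\in\Delta^d$, $$\min_{\alpha\in\mathbb{R}^p}\left(\sum_{j=1}^p\alpha_jx_j+\sum_{k=1}^dz_k\cdot\max_{j=1}^p(w^k_j-\alpha_j)\right)=\mathsf{Transport}(x,z;w^1,\dots,w^d).$$ (2) Therefore, let $D=\prod_{i=1}^\tau\Delta^{p_i}$ be a product of simplices with $\eta=p_1+\cdots+p_\tau$, and let $f^k(x)=\sum_{i=1}^\tau\sum_{j=1}^{p_i}w^k_{i,j}x_{i,j}+b^k$ for $k\in\{1,\dots,d\}$. In the system consisting of $$y\le\alpha\cdot x+\sum_{k=1}^d\left(\max_{x^k\in D}\{(w^k-\alpha)\cdot x^k\}+b^k\right)z_k\quad\forall\alpha\in\mathbb{R}^\eta,$$ $$y\ge f^k(x)\quad\forall k\in\{1,\dots,d\},\qquad (x,y,z)\in D\times\mathbb{R}\times\Delta^d,$$ the family of upper-bound constraints indexed by $\alpha\in\mathbb{R}^\eta$ can be replaced, without changing the solution set, with the single inequality $$y\le\sum_{i=1}^\tau\mathsf{Transport}\left((x_{i,j})_{j=1}^{p_i},z;(w^1_{i,j})_{j=1}^{p_i},\dots,(w^d_{i,j})_{j=1}^{p_i}\right)+\sum_{k=1}^db^kz_k.$$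
   Context: $\Delta^n=\{v\in\mathbb{R}^n_{\ge0}:\sum_iv_i=1\}$. Elements of $D=\prod_{i=1}^\tau\Delta^{p_i}$ are written $x=((x_{i,j})_{j=1}^{p_i})_{i=1}^\tau$ with $(x_{i,j})_{j=1}^{p_i}\in\Delta^{p_i}$ for each $i$, and vectors $w^k,\alpha\in\mathbb{R}^\eta$ are indexed in the same way. For $x\in\Delta^p$, $z\in\Delta^d$ and weights $w^k_j\in\mathbb{R}$, the max-weight transportation problem is $$\mathsf{Transport}(x,z;w^1,\dots,w^d)=\max_{\beta\ge0}\left\{\sum_{k=1}^d\sum_{j=1}^pw^k_j\beta^k_j:\ \sum_{k=1}^d\beta^k_j=x_j\ \forall j\in\{1,\dots,p\},\ \sum_{j=1}^p\beta^k_j=z_k\ \forall k\in\{1,\dots,d\}\right\}.$$ *)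

theory Defs
  imports "HOL-Analysis.Analysis"
begin

(* A vector indexed by {1..n} is a function on nat that is undefined outside {1..n}; this
   allows the block sizes p i to depend on i.  A doubly indexed vector is curried, so u i is
   block i of u. *)

definition rvec :: "nat \<Rightarrow> (nat \<Rightarrow> real) set" where
  "rvec n = ({1..n} \<rightarrow>\<^sub>E UNIV)"

definition prob_simplex :: "nat \<Rightarrow> (nat \<Rightarrow> real) set" where
  "prob_simplex n = {v \<in> rvec n. (\<forall>j\<in>{1..n}. 0 \<le> v j) \<and> (\<Sum>j=1..n. v j) = 1}"

definition block_vec :: "nat \<Rightarrow> (nat \<Rightarrow> nat) \<Rightarrow> (nat \<Rightarrow> nat \<Rightarrow> real) set" where
  "block_vec \<tau> p = (\<Pi>\<^sub>E i\<in>{1..\<tau>}. rvec (p i))"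

definition simplex_prod :: "nat \<Rightarrow> (nat \<Rightarrow> nat) \<Rightarrow> (nat \<Rightarrow> nat \<Rightarrow> real) set" where
  "simplex_prod \<tau> p = (\<Pi>\<^sub>E i\<in>{1..\<tau>}. prob_simplex (p i))"

definition block_dot ::
  "nat \<Rightarrow> (nat \<Rightarrow> nat) \<Rightarrow> (nat \<Rightarrow> nat \<Rightarrow> real) \<Rightarrow> (nat \<Rightarrow> nat \<Rightarrow> real) \<Rightarrow> real" where
  "block_dot \<tau> p u v = (\<Sum>i=1..\<tau>. \<Sum>j=1..p i. u i j * v i j)"

definition is_min_over :: "('a \<Rightarrow> real) \<Rightarrow> 'a set \<Rightarrow> real \<Rightarrow> bool" where
  "is_min_over f S m \<longleftrightarrow> (\<exists>a\<in>S. f a = m) \<and> (\<forall>a\<in>S. m \<le> f a)"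

definition is_max_over :: "('a \<Rightarrow> real) \<Rightarrow> 'a set \<Rightarrow> real \<Rightarrow> bool" where
  "is_max_over f S m \<longleftrightarrow> (\<exists>a\<in>S. f a = m) \<and> (\<forall>a\<in>S. f a \<le> m)"

(* Only meaningful when the maximum is attained; the two lemmas at the end of this theory show
   that it is, for the transportation problem and for linear functions on simplex_prod. *)
definition max_over :: "('a \<Rightarrow> real) \<Rightarrow> 'a set \<Rightarrow> real" where
  "max_over f S = (THE m. is_max_over f S m)"

definition transport_plans ::
  "nat \<Rightarrow> nat \<Rightarrow> (nat \<Rightarrow> real) \<Rightarrow> (nat \<Rightarrow> real) \<Rightarrow> (nat \<Rightarrow> nat \<Rightarrow> real) set" where
  "transport_plans p d x z =
     {\<beta> \<in> {1..d} \<rightarrow>\<^sub>E rvec p.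
        (\<forall>k\<in>{1..d}. \<forall>j\<in>{1..p}. 0 \<le> \<beta> k j) \<and>
        (\<forall>j\<in>{1..p}. (\<Sum>k=1..d. \<beta> k j) = x j) \<and>
        (\<forall>k\<in>{1..d}. (\<Sum>j=1..p. \<beta> k j) = z k)}"

definition Transport ::
  "nat \<Rightarrow> nat \<Rightarrow> (nat \<Rightarrow> real) \<Rightarrow> (nat \<Rightarrow> real) \<Rightarrow> (nat \<Rightarrow> nat \<Rightarrow> real) \<Rightarrow> real" where
  "Transport p d x z w =
     max_over (\<lambda>\<beta>. \<Sum>k=1..d. \<Sum>j=1..p. w k j * \<beta> k j) (transport_plans p d x z)"

lemma max_over_eqI: "is_max_over f S m \<Longrightarrow> max_over f S = m"
  unfolding max_over_def
  by (rule the_equality) (auto simp: is_max_over_def intro!: antisym)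

lemma is_max_over_max_over:
  fixes f :: "'a::topological_space \<Rightarrow> real"
  assumes "compact S" "S \<noteq> {}" "continuous_on S f"
  shows "is_max_over f S (max_over f S)"
proof -
  obtain a where "a \<in> S" "\<forall>y\<in>S. f y \<le> f a"
    using continuous_attains_sup[OF assms] by blast
  then have "is_max_over f S (f a)" by (auto simp: is_max_over_def)
  then show ?thesis using max_over_eqI by metis
qed

lemma compact_PiE_fun:
  fixes K :: "nat \<Rightarrow> 'b::topological_space set"
  assumes "\<And>i. i \<in> A \<Longrightarrow> compact (K i)"
  shows "compact (PiE A K)"
proof -
  have eq: "PiE A K = PiE UNIV (\<lambda>i. if i \<in> A then K i else {undefined})"
    by (auto simp: PiE_iff extensional_def split: if_splits)
  have "compactin (product_topology (\<lambda>i::nat. euclidean :: 'b topology) UNIV) (PiE A K)"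
    unfolding eq compactin_PiE using assms by auto
  then show ?thesis by (simp add: euclidean_product_topology)
qed

lemma continuous_on_coord: "continuous_on S (\<lambda>v. v (j::nat) :: real)"
  by (rule continuous_on_subset[OF continuous_on_product_coordinates]) auto

lemma continuous_on_coord2: "continuous_on S (\<lambda>v. v (i::nat) (j::nat) :: real)"
  by (rule continuous_on_product_then_coordinatewise[
        OF continuous_on_subset[OF continuous_on_product_coordinates]]) auto

lemma compact_prob_simplex: "compact (prob_simplex n)"
proof -
  have "prob_simplex n = PiE {1..n} (\<lambda>_. {0..1}) \<inter> {v. (\<Sum>j=1..n. v j) = 1}"
    (is "_ = ?R")
  proof
    show "prob_simplex n \<subseteq> ?R"
    proof
      fix v assume v: "v \<in> prob_simplex n"
      have "v j \<le> 1" if "j \<in> {1..n}" for j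
        using member_le_sum[of j "{1..n}" v] that v by (auto simp: prob_simplex_def)
      then show "v \<in> ?R" using v by (auto simp: prob_simplex_def rvec_def PiE_iff)
    qed
  qed (auto simp: prob_simplex_def rvec_def PiE_iff)
  moreover have "closed {v::nat\<Rightarrow>real. (\<Sum>j=1..n. v j) = 1}"
    by (intro closed_Collect_eq continuous_on_sum continuous_on_coord continuous_on_const)
  ultimately show ?thesis
    by (simp add: compact_Int_closed compact_PiE_fun)
qed

lemma compact_transport_plans:
  assumes "z \<in> prob_simplex d"
  shows "compact (transport_plans p d x z)"
proof -
  let ?B = "PiE {1..d} (\<lambda>_. PiE {1..p} (\<lambda>_. {0..1::real}))"
  let ?C = "(\<Inter>j\<in>{1..p}. {\<beta>::nat\<Rightarrow>nat\<Rightarrow>real. (\<Sum>k=1..d. \<beta> k j) = x j}) \<inter>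
            (\<Inter>k\<in>{1..d}. {\<beta>. (\<Sum>j=1..p. \<beta> k j) = z k})"
  have "transport_plans p d x z = ?B \<inter> ?C"
  proof
    show "transport_plans p d x z \<subseteq> ?B \<inter> ?C"
    proof
      fix \<beta> assume b: "\<beta> \<in> transport_plans p d x z"
      have "\<beta> k j \<le> 1" if "k \<in> {1..d}" "j \<in> {1..p}" for k j
      proof -
        have "\<beta> k j \<le> (\<Sum>j=1..p. \<beta> k j)"
          by (rule member_le_sum) (use that b in \<open>auto simp: transport_plans_def\<close>)
        also have "\<dots> = z k" using that b by (auto simp: transport_plans_def)
        also have "\<dots> \<le> (\<Sum>k=1..d. z k)"
          by (rule member_le_sum) (use that assms in \<open>auto simp: prob_simplex_def\<close>)
        also have "\<dots> = 1" using assms by (simp add: prob_simplex_def)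
        finally show ?thesis .
      qed
      then show "\<beta> \<in> ?B \<inter> ?C" using b
        by (auto simp: transport_plans_def rvec_def PiE_iff)
    qed
  qed (auto simp: transport_plans_def rvec_def PiE_iff)
  moreover have "closed ?C"
    by (intro closed_Int closed_INT ballI closed_Collect_eq continuous_on_sum
        continuous_on_coord2 continuous_on_const)
  moreover have "compact ?B" by (intro compact_PiE_fun) auto
  ultimately show ?thesis by (simp only: compact_Int_closed)
qed

lemma transport_plans_nonempty:
  assumes "x \<in> prob_simplex p" "z \<in> prob_simplex d"
  shows "transport_plans p d x z \<noteq> {}"
proof -
  have "(\<lambda>k\<in>{1..d}. \<lambda>j\<in>{1..p}. z k * x j) \<in> transport_plans p d x z"
    using assms
    by (auto simp: transport_plans_def prob_simplex_def rvec_def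
        simp flip: sum_distrib_left sum_distrib_right)
  then show ?thesis by blast
qed

lemma prob_simplex_nonempty:
  assumes "n \<ge> 1"
  shows "prob_simplex n \<noteq> {}"
proof -
  have "(\<lambda>j\<in>{1..n}. if j = 1 then 1 else 0) \<in> prob_simplex n"
    using assms by (auto simp: prob_simplex_def rvec_def)
  then show ?thesis by blast
qed

lemma Transport_attained:
  assumes "x \<in> prob_simplex p" "z \<in> prob_simplex d"
  shows "is_max_over (\<lambda>\<beta>. \<Sum>k=1..d. \<Sum>j=1..p. w k j * \<beta> k j) (transport_plans p d x z)
           (Transport p d x z w)"
  unfolding Transport_def using assms
  by (intro is_max_over_max_over compact_transport_plans transport_plans_nonempty
      continuous_on_sum continuous_on_mult continuous_on_const continuous_on_coord2)

lemma block_dot_max_attained: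
  assumes "\<And>i. i \<in> {1..\<tau>} \<Longrightarrow> p i \<ge> 1"
  shows "is_max_over (block_dot \<tau> p u) (simplex_prod \<tau> p)
           (max_over (block_dot \<tau> p u) (simplex_prod \<tau> p))"
proof (rule is_max_over_max_over)
  show "compact (simplex_prod \<tau> p)"
    unfolding simplex_prod_def by (intro compact_PiE_fun compact_prob_simplex)
  show "simplex_prod \<tau> p \<noteq> {}"
    unfolding simplex_prod_def using assms prob_simplex_nonempty by (auto simp: PiE_eq_empty_iff)
  show "continuous_on (simplex_prod \<tau> p) (block_dot \<tau> p u)"
    unfolding block_dot_def
    by (intro continuous_on_sum continuous_on_mult continuous_on_const continuous_on_coord2)
qed

end

theory Submission
  imports Defs
begin

text \<open>
  Weak duality is a rearrangement of sums. For the converse, fix an optimal plan \<open>\<beta>\<close>. A vector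
  \<open>\<alpha>\<close> attains the value of \<open>\<beta>\<close> as soon as \<open>w\<^sup>k\<^sub>i - \<alpha>\<^sub>i \<le> w\<^sup>k\<^sub>j - \<alpha>\<^sub>j\<close> whenever
  \<open>\<beta>\<^sup>k\<^sub>j > 0\<close> (complementary slackness). If this finite linear system had no solution,
  Fourier--Motzkin elimination would yield a nonnegative combination of its inequalities with zero
  left-hand side and positive right-hand side. The inequality for \<open>(k, j, i)\<close> corresponds to moving
  mass of \<open>\<beta>\<^sup>k\<close> from \<open>j\<close> to \<open>i\<close>, so the combination would be a direction that improves \<open>\<beta>\<close>.
  For the second part, both \<open>\<alpha> \<cdot> x\<close> and the maximum over \<open>D\<close> split over the blocks, so the
  minimum over \<open>\<alpha>\<close> can be taken in each block separately.
\<close>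

section \<open>Farkas' lemma by Fourier-Motzkin elimination\<close>

text \<open>A pair \<open>(a, b)\<close> encodes the inequality
  \<open>b \<le> (\<Sum>v\<in>V. a v * y v)\<close> in the unknown \<open>y\<close>. The cone is
  generated inductively, so that a property of an infeasibility certificate can be proved by rule
  induction.\<close>

inductive_set nonneg_combs :: "(('v \<Rightarrow> real) \<times> real) set \<Rightarrow> (('v \<Rightarrow> real) \<times> real) set"
  for S where
  base: "(a, b) \<in> S \<Longrightarrow> (a, b) \<in> nonneg_combs S"
| add: "(a, b) \<in> nonneg_combs S \<Longrightarrow> (a', b') \<in> nonneg_combs S \<Longrightarrow>
    (\<lambda>v. a v + a' v, b + b') \<in> nonneg_combs S"
| scale: "(a, b) \<in> nonneg_combs S \<Longrightarrow> 0 \<le> c \<Longrightarrow> (\<lambda>v. c * a v, c * b) \<in> nonneg_combs S"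

lemma nonneg_combs_subset:
  assumes "S' \<subseteq> nonneg_combs S"
  shows "nonneg_combs S' \<subseteq> nonneg_combs S"
proof clarify
  fix a b assume "(a, b) \<in> nonneg_combs S'"
  then show "(a, b) \<in> nonneg_combs S"
    by induction (use assms in \<open>auto intro: nonneg_combs.intros\<close>)
qed

lemma finite_sets_separated:
  fixes L U :: "real set"
  assumes "finite L" "finite U" "\<And>l u. l \<in> L \<Longrightarrow> u \<in> U \<Longrightarrow> l \<le> u"
  obtains v where "\<And>l. l \<in> L \<Longrightarrow> l \<le> v" "\<And>u. u \<in> U \<Longrightarrow> v \<le> u"
proof (cases "L = {}")
  case True
  show ?thesis
  proof (cases "U = {}")
    case False
    with True assms show ?thesis by (intro that[of "Min U"]) auto
  qed (use True that in auto)
next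
  case False
  with assms show ?thesis by (intro that[of "Max L"]) auto
qed

text \<open>Meant for \<open>s\<close> with positive and \<open>t\<close> with negative coefficient
  at \<open>i\<close>: both are scaled by positive factors to coefficients 1 and -1, so that the
  variable \<open>i\<close> cancels in the sum.\<close>

definition eliminate :: "'v \<Rightarrow> ('v \<Rightarrow> real) \<times> real \<Rightarrow> ('v \<Rightarrow> real) \<times> real \<Rightarrow> ('v \<Rightarrow> real) \<times> real" where
  "eliminate i s t =
     (\<lambda>v. 1 / fst s i * fst s v + 1 / - fst t i * fst t v,
      1 / fst s i * snd s + 1 / - fst t i * snd t)"

text \<open>Induction on the variables. A solution of the system \<open>S'\<close> without
  \<open>i\<close> extends to one of \<open>S\<close>, so infeasibility passes to \<open>S'\<close>.
  A certificate for \<open>S'\<close> is one for \<open>S\<close>, since \<open>S'\<close> lies in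
  the cone of \<open>S\<close>.\<close>

lemma fourier_motzkin:
  fixes S :: "(('v \<Rightarrow> real) \<times> real) set"
  assumes "finite V" "finite S" "\<nexists>y. \<forall>(a, b)\<in>S. b \<le> (\<Sum>v\<in>V. a v * y v)"
  shows "\<exists>(a, b)\<in>nonneg_combs S. (\<forall>v\<in>V. a v = 0) \<and> 0 < b"
  using assms
proof (induction V arbitrary: S rule: finite_induct)
  case empty
  then obtain a b where "(a, b) \<in> S" "\<not> b \<le> 0" by auto
  then show ?case by (intro bexI[OF _ nonneg_combs.base]) auto
next
  case (insert i V)
  define P where "P = {s\<in>S. 0 < fst s i}"
  define N where "N = {s\<in>S. fst s i < 0}"
  define Z where "Z = {s\<in>S. fst s i = 0}"
  define S' where "S' = Z \<union> case_prod (eliminate i) ` (P \<times> N)"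
  have fin: "finite P" "finite N" "finite S'"
    using insert.prems by (auto simp: P_def N_def Z_def S'_def)
  have S: "S = P \<union> N \<union> Z" by (auto simp: P_def N_def Z_def)
  have infeasible: "\<nexists>y. \<forall>(a, b)\<in>S'. b \<le> (\<Sum>v\<in>V. a v * y v)"
  proof
    assume "\<exists>y. \<forall>(a, b)\<in>S'. b \<le> (\<Sum>v\<in>V. a v * y v)"
    then obtain y where y: "\<And>a b. (a, b) \<in> S' \<Longrightarrow> b \<le> (\<Sum>v\<in>V. a v * y v)" by blast
    \<comment> \<open>With the other variables fixed at \<open>y\<close>, this is the bound that
      \<open>s\<close> puts on variable \<open>i\<close>: a lower bound for
      \<open>s \<in> P\<close>, an upper bound for \<open>s \<in> N\<close>.\<close>
    define B where "B s = (snd s - (\<Sum>v\<in>V. fst s v * y v)) / fst s i" for s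
    have B_le: "B s \<le> B t" if st: "s \<in> P" "t \<in> N" for s t
    proof -
      have "eliminate i s t \<in> S'" using st by (force simp: S'_def)
      then have "1 / fst s i * snd s + 1 / - fst t i * snd t
          \<le> (\<Sum>v\<in>V. (1 / fst s i * fst s v + 1 / - fst t i * fst t v) * y v)"
        unfolding eliminate_def by (rule y)
      also have "\<dots> = 1 / fst s i * (\<Sum>v\<in>V. fst s v * y v) + 1 / - fst t i * (\<Sum>v\<in>V. fst t v * y v)"
        by (simp only: distrib_right sum.distrib sum_distrib_left mult.assoc)
      finally show ?thesis by (simp add: B_def diff_divide_distrib)
    qed
    obtain u where u: "\<And>s. s \<in> P \<Longrightarrow> B s \<le> u" "\<And>t. t \<in> N \<Longrightarrow> u \<le> B t"
      by (rule finite_sets_separated[of "B ` P" "B ` N"])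
        (use fin B_le in \<open>blast+\<close>)
    have "snd s \<le> (\<Sum>v\<in>insert i V. fst s v * (y(i := u)) v)" if "s \<in> S" for s
    proof -
      have sum_eq: "(\<Sum>v\<in>insert i V. fst s v * (y(i := u)) v)
          = fst s i * u + (\<Sum>v\<in>V. fst s v * y v)"
        using insert.hyps by (auto intro!: sum.cong)
      consider "s \<in> P" | "s \<in> N" | "s \<in> Z" using \<open>s \<in> S\<close> S by blast
      then show ?thesis
      proof cases
        case 1
        with u(1)[OF 1] show ?thesis unfolding sum_eq by (simp add: B_def P_def field_simps)
      next
        case 2
        with u(2)[OF 2] show ?thesis unfolding sum_eq by (simp add: B_def N_def field_simps)
      next
        case 3
        then have "s \<in> S'" by (simp add: S'_def)
        with y[of "fst s" "snd s"] 3 show ?thesis unfolding sum_eq by (simp add: Z_def)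
      qed
    qed
    then have "\<forall>(a, b)\<in>S. b \<le> (\<Sum>v\<in>insert i V. a v * (y(i := u)) v)" by fastforce
    with insert.prems(2) show False by blast
  qed
  obtain a b where ab: "(a, b) \<in> nonneg_combs S'" "\<forall>v\<in>V. a v = 0" "0 < b"
    using insert.IH[OF fin(3) infeasible] by blast
  have "S' \<subseteq> nonneg_combs S"
  proof
    fix s assume "s \<in> S'"
    then consider "s \<in> Z" | t t' where "t \<in> P" "t' \<in> N" "s = eliminate i t t'"
      by (auto simp: S'_def)
    then show "s \<in> nonneg_combs S"
    proof cases
      case 1
      then show ?thesis using nonneg_combs.base[of "fst s" "snd s" S] by (simp add: Z_def)
    next
      case 2
      have "t \<in> nonneg_combs S" "t' \<in> nonneg_combs S"
        using nonneg_combs.base[of "fst t" "snd t" S] nonneg_combs.base[of "fst t'" "snd t'" S] 2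
        by (simp_all add: P_def N_def)
      then show ?thesis unfolding 2(3) eliminate_def
        by (intro nonneg_combs.add nonneg_combs.scale) (use 2 in \<open>auto simp: P_def N_def\<close>)
    qed
  qed
  then have "(a, b) \<in> nonneg_combs S" using nonneg_combs_subset ab(1) by blast
  \<comment> \<open>The induction hypothesis controls \<open>a\<close> only on \<open>V\<close>. At
    \<open>i\<close>, every member of \<open>S'\<close> has coefficient zero, and the cone
    operations preserve this.\<close>
  moreover have "a i = 0" using ab(1)
  proof induction
    case (base a b)
    then show ?case by (auto simp: S'_def Z_def P_def N_def eliminate_def)
  qed auto
  ultimately show ?case using ab by auto
qed

section \<open>Duality for the transportation problem\<close>

text \<open>Replacing \<open>x\<close> and \<open>z\<close> by the marginals of
  \<open>\<beta>\<close> writes the dual objective as a sum over the entries of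
  \<open>\<beta>\<close>. Weak duality and tightness then become entrywise comparisons of
  \<open>\<alpha> j + M k\<close> with \<open>w k j\<close>.\<close>

lemma transport_value_decomp:
  assumes "\<beta> \<in> transport_plans p d x z"
  shows "(\<Sum>j=1..p. \<alpha> j * x j) + (\<Sum>k=1..d. z k * M k)
    = (\<Sum>k=1..d. \<Sum>j=1..p. (\<alpha> j + M k) * \<beta> k j)"
proof -
  have "(\<Sum>j=1..p. \<alpha> j * x j) = (\<Sum>j=1..p. \<alpha> j * (\<Sum>k=1..d. \<beta> k j))"
    using assms by (auto simp: transport_plans_def intro!: sum.cong)
  also have "\<dots> = (\<Sum>k=1..d. \<Sum>j=1..p. \<alpha> j * \<beta> k j)"
    by (simp only: sum_distrib_left) (rule sum.swap)
  finally have \<alpha>: "(\<Sum>j=1..p. \<alpha> j * x j) = (\<Sum>k=1..d. \<Sum>j=1..p. \<alpha> j * \<beta> k j)" .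
  have "(\<Sum>k=1..d. z k * M k) = (\<Sum>k=1..d. (\<Sum>j=1..p. \<beta> k j) * M k)"
    using assms by (auto simp: transport_plans_def intro!: sum.cong)
  also have "\<dots> = (\<Sum>k=1..d. \<Sum>j=1..p. M k * \<beta> k j)"
    by (simp add: sum_distrib_left mult.commute)
  finally show ?thesis by (simp only: \<alpha> distrib_right sum.distrib)
qed

lemma transport_weak_duality:
  assumes "\<beta> \<in> transport_plans p d x z"
  shows "(\<Sum>k=1..d. \<Sum>j=1..p. w k j * \<beta> k j)
    \<le> (\<Sum>j=1..p. \<alpha> j * x j) + (\<Sum>k=1..d. z k * (MAX j\<in>{1..p}. w k j - \<alpha> j))"
  unfolding transport_value_decomp[OF assms]
proof (intro sum_mono mult_right_mono)
  fix k j assume kj: "k \<in> {1..d}" "j \<in> {1..p}"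
  then have "w k j - \<alpha> j \<le> (MAX j\<in>{1..p}. w k j - \<alpha> j)" by (intro Max_ge) auto
  then show "w k j \<le> \<alpha> j + (MAX j\<in>{1..p}. w k j - \<alpha> j)" by simp
  show "0 \<le> \<beta> k j" using assms kj by (simp add: transport_plans_def)
qed

text \<open>A positive \<open>f i\<close> stays positive for small \<open>e\<close> by continuity,
  and a zero \<open>f i\<close> is handled by the sign of \<open>g i\<close>. Finiteness of
  \<open>I\<close> gives a common step.\<close>

lemma small_step_nonneg:
  fixes f g :: "'i \<Rightarrow> real"
  assumes "finite I" "\<And>i. i \<in> I \<Longrightarrow> 0 \<le> f i" "\<And>i. i \<in> I \<Longrightarrow> f i = 0 \<Longrightarrow> 0 \<le> g i"
  obtains e where "0 < e" "\<And>i. i \<in> I \<Longrightarrow> 0 \<le> f i + e * g i"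
proof -
  have "\<forall>\<^sub>F e in at_right 0. 0 \<le> f i + e * g i" if "i \<in> I" for i
  proof (cases "f i = 0")
    case True
    then show ?thesis using assms(3)[OF that] by (auto intro: eventually_mono[OF eventually_at_right_less])
  next
    case False
    have "((\<lambda>e. f i + e * g i) \<longlongrightarrow> f i + 0 * g i) (at_right 0)" by (intro tendsto_intros)
    then have "\<forall>\<^sub>F e in at_right 0. 0 < f i + e * g i"
      by (rule order_tendstoD) (use False assms(2)[OF that] in auto)
    then show ?thesis by (rule eventually_mono) auto
  qed
  then have "\<forall>\<^sub>F e in at_right 0. 0 < e \<and> (\<forall>i\<in>I. 0 \<le> f i + e * g i)"
    using assms(1) by (intro eventually_conj eventually_at_right_less eventually_ball_finite) auto
  from eventually_happens'[OF _ this] show thesis using that by auto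
qed

text \<open>Vanishing row and column sums preserve the marginals, and the sign condition keeps a
  small step along \<open>\<gamma>\<close> nonnegative. The step therefore ends in a plan, which
  cannot beat the optimal \<open>\<beta>\<close>.\<close>

lemma transport_optimal_direction:
  assumes \<beta>: "\<beta> \<in> transport_plans p d x z"
    and optimal: "\<And>\<beta>'. \<beta>' \<in> transport_plans p d x z \<Longrightarrow>
      (\<Sum>k=1..d. \<Sum>j=1..p. w k j * \<beta>' k j) \<le> (\<Sum>k=1..d. \<Sum>j=1..p. w k j * \<beta> k j)"
    and rows: "\<And>k. k \<in> {1..d} \<Longrightarrow> (\<Sum>j=1..p. \<gamma> k j) = 0"
    and cols: "\<And>j. j \<in> {1..p} \<Longrightarrow> (\<Sum>k=1..d. \<gamma> k j) = 0"
    and sign: "\<And>k j. k \<in> {1..d} \<Longrightarrow> j \<in> {1..p} \<Longrightarrow> \<beta> k j = 0 \<Longrightarrow> 0 \<le> \<gamma> k j"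
  shows "(\<Sum>k=1..d. \<Sum>j=1..p. w k j * \<gamma> k j) \<le> 0"
proof -
  obtain e where e: "0 < e" "\<And>k j. k \<in> {1..d} \<Longrightarrow> j \<in> {1..p} \<Longrightarrow> 0 \<le> \<beta> k j + e * \<gamma> k j"
    by (rule small_step_nonneg[of "{1..d} \<times> {1..p}" "case_prod \<beta>" "case_prod \<gamma>"])
      (use \<beta> sign in \<open>auto simp: transport_plans_def\<close>)
  let ?\<beta>' = "\<lambda>k\<in>{1..d}. \<lambda>j\<in>{1..p}. \<beta> k j + e * \<gamma> k j"
  have "?\<beta>' \<in> transport_plans p d x z"
    using e \<beta> rows cols
    by (auto simp: transport_plans_def rvec_def sum.distrib simp flip: sum_distrib_left)
  from optimal[OF this] have "e * (\<Sum>k=1..d. \<Sum>j=1..p. w k j * \<gamma> k j) \<le> 0"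
    by (simp add: algebra_simps sum.distrib sum_distrib_left)
  with e(1) show ?thesis by (simp add: mult_le_0_iff)
qed

text \<open>This is complementary slackness: \<open>j\<close> maximizes
  \<open>w k i - \<alpha> i\<close> over \<open>i\<close> wherever \<open>\<beta> k j\<close> is
  positive.\<close>

lemma transport_potential:
  assumes \<beta>: "\<beta> \<in> transport_plans p d x z"
    and optimal: "\<And>\<beta>'. \<beta>' \<in> transport_plans p d x z \<Longrightarrow>
      (\<Sum>k=1..d. \<Sum>j=1..p. w k j * \<beta>' k j) \<le> (\<Sum>k=1..d. \<Sum>j=1..p. w k j * \<beta> k j)"
  obtains \<alpha> where "\<And>k i j. k \<in> {1..d} \<Longrightarrow> i \<in> {1..p} \<Longrightarrow> j \<in> {1..p} \<Longrightarrow> 0 < \<beta> k j \<Longrightarrow>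
    w k i - \<alpha> i \<le> w k j - \<alpha> j"
proof -
  define T where "T = {(k, i, j). k \<in> {1..d} \<and> i \<in> {1..p} \<and> j \<in> {1..p} \<and> 0 < \<beta> k j}"
  \<comment> \<open>The triple \<open>(k, i, j)\<close> encodes
    \<open>w k i - w k j \<le> y i - y j\<close>, with \<open>y\<close> in the role of
    \<alpha>.\<close>
  define row where "row = (\<lambda>(k, i, j). (\<lambda>v. of_bool (v = i) - of_bool (v = j) :: real, w k i - w k j))"
  have "finite T" by (rule finite_subset[of _ "{1..d} \<times> {1..p} \<times> {1..p}"]) (auto simp: T_def)
  have "\<exists>y. \<forall>(a, b)\<in>row ` T. b \<le> (\<Sum>v=1..p. a v * y v)"
  proof (rule ccontr)
    assume "\<not> ?thesis"
    from fourier_motzkin[OF _ _ this] \<open>finite T\<close> obtain a b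
      where ab: "(a, b) \<in> nonneg_combs (row ` T)" and a0: "\<forall>v\<in>{1..p}. a v = 0" and "0 < b"
      by auto
    \<comment> \<open>The certificate becomes a direction: \<open>a\<close> gives its column sums
      and \<open>b\<close> its gain. The claim is made for all members of the cone so that the
      induction closes; \<open>a0\<close> makes the column sums vanish only afterwards.\<close>
    have "\<exists>\<gamma>. (\<forall>k\<in>{1..d}. (\<Sum>j=1..p. \<gamma> k j) = 0) \<and> (\<forall>j\<in>{1..p}. (\<Sum>k=1..d. \<gamma> k j) = a j) \<and>
        (\<forall>k\<in>{1..d}. \<forall>j\<in>{1..p}. \<beta> k j = 0 \<longrightarrow> 0 \<le> \<gamma> k j) \<and>
        (\<Sum>k=1..d. \<Sum>j=1..p. w k j * \<gamma> k j) = b"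
      using ab
    proof induction
      case (base a b)
      then obtain k i j where kij: "k \<in> {1..d}" "i \<in> {1..p}" "j \<in> {1..p}" "0 < \<beta> k j"
        and ab: "a = (\<lambda>v. of_bool (v = i) - of_bool (v = j))" "b = w k i - w k j"
        by (auto simp: T_def row_def)
      have sum_of_bool: "(\<Sum>v=1..n. f v * of_bool (v = u)) = (f u :: real)" if "u \<in> {1..n}"
        for f and u n :: nat
        using that by (simp add: of_bool_def if_distrib sum.delta cong: if_cong)
      have eq1: "(\<Sum>v=1..n. of_bool (v = u)) = (1 :: real)" if "u \<in> {1..n}" for u n :: nat
        using sum_of_bool[OF that, of "\<lambda>_. 1"] by simp
      \<comment> \<open>One unit of row \<open>k\<close> moves from column \<open>j\<close> to
        column \<open>i\<close>. The only entry that can be negative is at \<open>(k, j)\<close>,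
        where \<beta> is positive.\<close>
      define \<gamma> :: "nat \<Rightarrow> nat \<Rightarrow> real"
        where "\<gamma> l v = of_bool (l = k) * (of_bool (v = i) - of_bool (v = j))" for l v
      have "(\<Sum>v=1..p. \<gamma> l v) = 0" for l
        using kij by (simp add: \<gamma>_def sum_subtractf eq1 flip: sum_distrib_left)
      moreover have "(\<Sum>l=1..d. \<gamma> l v) = a v" for v
        unfolding \<gamma>_def ab using kij by (simp add: eq1 flip: sum_distrib_right)
      moreover have "0 \<le> \<gamma> l v" if "\<beta> l v = 0" for l v
        using that kij by (auto simp: \<gamma>_def)
      moreover have "(\<Sum>l=1..d. \<Sum>v=1..p. w l v * \<gamma> l v) = b"
      proof -
        have "(\<Sum>v=1..p. w l v * \<gamma> l v) = (w l i - w l j) * of_bool (l = k)" for l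
          using kij by (simp add: \<gamma>_def right_diff_distrib sum_subtractf sum_of_bool)
        then show ?thesis using kij by (simp add: sum_of_bool ab)
      qed
      ultimately show ?case by blast
    next
      case (add a b a' b')
      then obtain \<gamma> \<gamma>' where "\<forall>k\<in>{1..d}. (\<Sum>j=1..p. \<gamma> k j) = 0" "\<forall>j\<in>{1..p}. (\<Sum>k=1..d. \<gamma> k j) = a j"
        "\<forall>k\<in>{1..d}. \<forall>j\<in>{1..p}. \<beta> k j = 0 \<longrightarrow> 0 \<le> \<gamma> k j"
        "(\<Sum>k=1..d. \<Sum>j=1..p. w k j * \<gamma> k j) = b"
        "\<forall>k\<in>{1..d}. (\<Sum>j=1..p. \<gamma>' k j) = 0" "\<forall>j\<in>{1..p}. (\<Sum>k=1..d. \<gamma>' k j) = a' j"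
        "\<forall>k\<in>{1..d}. \<forall>j\<in>{1..p}. \<beta> k j = 0 \<longrightarrow> 0 \<le> \<gamma>' k j"
        "(\<Sum>k=1..d. \<Sum>j=1..p. w k j * \<gamma>' k j) = b'"
        by blast
      then show ?case
        by (intro exI[of _ "\<lambda>k j. \<gamma> k j + \<gamma>' k j"]) (simp add: sum.distrib distrib_left)
    next
      case (scale a b c)
      then obtain \<gamma> where "\<forall>k\<in>{1..d}. (\<Sum>j=1..p. \<gamma> k j) = 0" "\<forall>j\<in>{1..p}. (\<Sum>k=1..d. \<gamma> k j) = a j"
        "\<forall>k\<in>{1..d}. \<forall>j\<in>{1..p}. \<beta> k j = 0 \<longrightarrow> 0 \<le> \<gamma> k j"
        "(\<Sum>k=1..d. \<Sum>j=1..p. w k j * \<gamma> k j) = b"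
        by blast
      with scale(2) show ?case
        by (intro exI[of _ "\<lambda>k j. c * \<gamma> k j"])
          (simp add: mult.left_commute flip: sum_distrib_left)
    qed
    then obtain \<gamma> where "\<forall>k\<in>{1..d}. (\<Sum>j=1..p. \<gamma> k j) = 0" "\<forall>j\<in>{1..p}. (\<Sum>k=1..d. \<gamma> k j) = a j"
      "\<forall>k\<in>{1..d}. \<forall>j\<in>{1..p}. \<beta> k j = 0 \<longrightarrow> 0 \<le> \<gamma> k j"
      and b: "(\<Sum>k=1..d. \<Sum>j=1..p. w k j * \<gamma> k j) = b"
      by blast
    then have "(\<Sum>k=1..d. \<Sum>j=1..p. w k j * \<gamma> k j) \<le> 0"
      using a0 by (intro transport_optimal_direction[OF \<beta> optimal]) auto
    with b \<open>0 < b\<close> show False by simp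
  qed
  then obtain y where y: "\<And>t. t \<in> T \<Longrightarrow> snd (row t) \<le> (\<Sum>v=1..p. fst (row t) v * y v)"
    by fastforce
  show thesis
  proof
    fix k i j assume kij: "k \<in> {1..d}" "i \<in> {1..p}" "j \<in> {1..p}" "0 < \<beta> k j"
    have "w k i - w k j \<le> (\<Sum>v=1..p. (of_bool (v = i) - of_bool (v = j)) * y v)"
      using y[of "(k, i, j)"] kij by (simp add: T_def row_def)
    also have "\<dots> = (\<Sum>v=1..p. (if v = i then y v else 0) - (if v = j then y v else 0))"
      by (intro sum.cong) auto
    also have "\<dots> = y i - y j" using kij by (simp add: sum_subtractf sum.delta)
    finally show "w k i - y i \<le> w k j - y j" by simp
  qed
qed

text \<open>An optimal plan exists by compactness. Its potential makes the entrywise comparison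
  tight, and weak duality bounds every other \<alpha> from below.\<close>

lemma transport_strong_duality:
  assumes x: "x \<in> prob_simplex p" and z: "z \<in> prob_simplex d"
  shows "is_min_over
    (\<lambda>\<alpha>. (\<Sum>j=1..p. \<alpha> j * x j) + (\<Sum>k=1..d. z k * (MAX j\<in>{1..p}. w k j - \<alpha> j)))
    (rvec p) (Transport p d x z w)"
    (is "is_min_over ?g _ _")
proof -
  obtain \<beta> where \<beta>: "\<beta> \<in> transport_plans p d x z"
    and val: "(\<Sum>k=1..d. \<Sum>j=1..p. w k j * \<beta> k j) = Transport p d x z w"
    and opt: "\<And>\<beta>'. \<beta>' \<in> transport_plans p d x z \<Longrightarrow>
      (\<Sum>k=1..d. \<Sum>j=1..p. w k j * \<beta>' k j) \<le> (\<Sum>k=1..d. \<Sum>j=1..p. w k j * \<beta> k j)"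
    using Transport_attained[OF x z, of w] by (auto simp: is_max_over_def)
  obtain \<alpha> where \<alpha>: "\<And>k i j. k \<in> {1..d} \<Longrightarrow> i \<in> {1..p} \<Longrightarrow> j \<in> {1..p} \<Longrightarrow> 0 < \<beta> k j \<Longrightarrow>
      w k i - \<alpha> i \<le> w k j - \<alpha> j"
    using transport_potential[OF \<beta> opt] by blast
  \<comment> \<open>Members of \<open>rvec p\<close> are undefined outside \<open>{1..p}\<close>;
    the objective reads only indices inside.\<close>
  let ?\<alpha> = "restrict \<alpha> {1..p}"
  have "?g ?\<alpha> = (\<Sum>k=1..d. \<Sum>j=1..p. w k j * \<beta> k j)"
    unfolding transport_value_decomp[OF \<beta>]
  proof (intro sum.cong refl)
    fix k j assume kj: "k \<in> {1..d}" "j \<in> {1..p}"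
    show "(?\<alpha> j + (MAX j\<in>{1..p}. w k j - ?\<alpha> j)) * \<beta> k j = w k j * \<beta> k j"
    \<comment> \<open>Where \<beta> vanishes both sides are zero; elsewhere slackness says that
      \<open>j\<close> attains the maximum, so \<open>?\<alpha> j\<close> cancels.\<close>
    proof (cases "\<beta> k j = 0")
      case False
      with \<beta> kj have "0 < \<beta> k j" by (auto simp: transport_plans_def less_le)
      with \<alpha> kj have "(MAX j\<in>{1..p}. w k j - ?\<alpha> j) = w k j - ?\<alpha> j"
        by (intro Max_eqI) auto
      then show ?thesis by simp
    qed simp
  qed
  then have "?g ?\<alpha> = Transport p d x z w" unfolding val .
  moreover have "?\<alpha> \<in> rvec p" by (auto simp: rvec_def)
  ultimately show ?thesis
    using transport_weak_duality[OF \<beta>, of w] unfolding is_min_over_def val by blast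
qed

section \<open>Splitting over the blocks of the product of simplices\<close>

text \<open>Within a block the linear form is a weighted average of the \<open>u i j\<close>, so it
  is at most their maximum; a vertex of the product attains all these bounds at once.\<close>

lemma max_block_dot:
  assumes p: "\<And>i. i \<in> {1..\<tau>} \<Longrightarrow> p i \<ge> 1"
  shows "max_over (block_dot \<tau> p u) (simplex_prod \<tau> p) = (\<Sum>i=1..\<tau>. MAX j\<in>{1..p i}. u i j)"
proof (rule max_over_eqI, unfold is_max_over_def, intro conjI ballI)
  have "\<exists>m\<in>{1..p i}. u i m = (MAX j\<in>{1..p i}. u i j)" if "i \<in> {1..\<tau>}" for i
    using Max_in[of "u i ` {1..p i}"] p[OF that] by fastforce
  then obtain m where m: "\<And>i. i \<in> {1..\<tau>} \<Longrightarrow> m i \<in> {1..p i} \<and> u i (m i) = (MAX j\<in>{1..p i}. u i j)"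
    by metis
  \<comment> \<open>The vertex whose block \<open>i\<close> is the unit vector at a maximizing index
    \<open>m i\<close>.\<close>
  let ?v = "\<lambda>i\<in>{1..\<tau>}. \<lambda>j\<in>{1..p i}. if j = m i then 1 else 0 :: real"
  have "?v \<in> simplex_prod \<tau> p"
    using m by (auto simp: simplex_prod_def prob_simplex_def rvec_def)
  moreover have "block_dot \<tau> p u ?v = (\<Sum>i=1..\<tau>. MAX j\<in>{1..p i}. u i j)"
    unfolding block_dot_def
  proof (intro sum.cong refl)
    fix i assume i: "i \<in> {1..\<tau>}"
    have "(\<Sum>j=1..p i. u i j * ?v i j) = (\<Sum>j=1..p i. if j = m i then u i j else 0)"
      using i by (intro sum.cong) auto
    also have "\<dots> = u i (m i)" using m[OF i] by (simp add: sum.delta)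
    finally show "(\<Sum>j=1..p i. u i j * ?v i j) = (MAX j\<in>{1..p i}. u i j)" using m[OF i] by simp
  qed
  ultimately show "\<exists>v\<in>simplex_prod \<tau> p. block_dot \<tau> p u v = (\<Sum>i=1..\<tau>. MAX j\<in>{1..p i}. u i j)"
    by blast
next
  fix x assume x: "x \<in> simplex_prod \<tau> p"
  show "block_dot \<tau> p u x \<le> (\<Sum>i=1..\<tau>. MAX j\<in>{1..p i}. u i j)"
    unfolding block_dot_def
  proof (rule sum_mono)
    fix i assume "i \<in> {1..\<tau>}"
    then have xi: "x i \<in> prob_simplex (p i)" using x by (auto simp: simplex_prod_def)
    have "(\<Sum>j=1..p i. u i j * x i j) \<le> (\<Sum>j=1..p i. (MAX j\<in>{1..p i}. u i j) * x i j)"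
      using xi by (intro sum_mono mult_right_mono) (auto simp: prob_simplex_def)
    also have "\<dots> = (MAX j\<in>{1..p i}. u i j)"
      using xi by (simp add: prob_simplex_def flip: sum_distrib_left)
    finally show "(\<Sum>j=1..p i. u i j * x i j) \<le> (MAX j\<in>{1..p i}. u i j)" .
  qed
qed

text \<open>Neither the objective nor the domain couples the blocks, so blockwise minimizers can be
  glued together.\<close>

lemma is_min_over_blocks:
  assumes "\<And>i. i \<in> I \<Longrightarrow> is_min_over (g i) (A i) (m i)"
  shows "is_min_over (\<lambda>\<alpha>. \<Sum>i\<in>I. g i (\<alpha> i)) (\<Pi>\<^sub>E i\<in>I. A i) (\<Sum>i\<in>I. m i)"
proof -
  from assms obtain a where "\<And>i. i \<in> I \<Longrightarrow> a i \<in> A i \<and> g i (a i) = m i"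
    unfolding is_min_over_def by metis
  then have "restrict a I \<in> (\<Pi>\<^sub>E i\<in>I. A i)" "(\<Sum>i\<in>I. g i (restrict a I i)) = (\<Sum>i\<in>I. m i)"
    by auto
  moreover have "(\<Sum>i\<in>I. m i) \<le> (\<Sum>i\<in>I. g i (\<alpha> i))" if "\<alpha> \<in> (\<Pi>\<^sub>E i\<in>I. A i)" for \<alpha>
    using assms that by (intro sum_mono) (auto simp: is_min_over_def)
  ultimately show ?thesis unfolding is_min_over_def by blast
qed

text \<open>Up to the constant \<open>(\<Sum>k=1..d. b k * z k)\<close>, each right-hand side is a
  sum over \<open>i\<close> of the dual objective \<open>?g i\<close> of block \<open>i\<close>.
  Strong duality gives the minimum over \<alpha>; as it is attained, lying below all values means
  lying below the minimum.\<close>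

lemma upper_bounds_iff_Transport:
  assumes p: "\<forall>i\<in>{1..\<tau>}. p i \<ge> 1"
    and x: "x \<in> simplex_prod \<tau> p" and z: "z \<in> prob_simplex d"
  shows "(\<forall>\<alpha>\<in>block_vec \<tau> p. y \<le> block_dot \<tau> p \<alpha> x +
      (\<Sum>k=1..d. (max_over (block_dot \<tau> p (\<lambda>i j. w k i j - \<alpha> i j)) (simplex_prod \<tau> p) + b k) * z k))
    \<longleftrightarrow> y \<le> (\<Sum>i=1..\<tau>. Transport (p i) d (x i) z (\<lambda>k. w k i)) + (\<Sum>k=1..d. b k * z k)"
proof -
  let ?g = "\<lambda>i \<alpha>. (\<Sum>j=1..p i. \<alpha> j * x i j) + (\<Sum>k=1..d. z k * (MAX j\<in>{1..p i}. w k i j - \<alpha> j))"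
  have "block_dot \<tau> p \<alpha> x +
      (\<Sum>k=1..d. (max_over (block_dot \<tau> p (\<lambda>i j. w k i j - \<alpha> i j)) (simplex_prod \<tau> p) + b k) * z k)
    = (\<Sum>i=1..\<tau>. ?g i (\<alpha> i)) + (\<Sum>k=1..d. b k * z k)" for \<alpha>
  proof -
    let ?M = "\<lambda>k i. MAX j\<in>{1..p i}. w k i j - \<alpha> i j"
    have "(\<Sum>k=1..d. (\<Sum>i=1..\<tau>. ?M k i) * z k) = (\<Sum>k=1..d. \<Sum>i=1..\<tau>. z k * ?M k i)"
      by (simp add: sum_distrib_left mult.commute)
    also have "\<dots> = (\<Sum>i=1..\<tau>. \<Sum>k=1..d. z k * ?M k i)" by (rule sum.swap)
    moreover have "max_over (block_dot \<tau> p (\<lambda>i j. w k i j - \<alpha> i j)) (simplex_prod \<tau> p)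
        = (\<Sum>i=1..\<tau>. ?M k i)" for k
      using p by (intro max_block_dot) auto
    ultimately show ?thesis by (simp add: block_dot_def distrib_right sum.distrib)
  qed
  moreover have "is_min_over (\<lambda>\<alpha>. \<Sum>i=1..\<tau>. ?g i (\<alpha> i)) (block_vec \<tau> p)
      (\<Sum>i=1..\<tau>. Transport (p i) d (x i) z (\<lambda>k. w k i))"
    unfolding block_vec_def
    by (intro is_min_over_blocks transport_strong_duality z) (use x in \<open>auto simp: simplex_prod_def\<close>)
  ultimately show ?thesis unfolding is_min_over_def by fastforce
qed

theorem proposition7:
  shows
    "(\<forall>(p::nat) (d::nat) (w :: nat \<Rightarrow> nat \<Rightarrow> real) (x :: nat \<Rightarrow> real) (z :: nat \<Rightarrow> real).
        p \<ge> 1 \<longrightarrow> d \<ge> 1 \<longrightarrow> (\<forall>k\<in>{1..d}. w k \<in> rvec p) \<longrightarrow>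
        x \<in> prob_simplex p \<longrightarrow> z \<in> prob_simplex d \<longrightarrow>
        is_min_over
          (\<lambda>\<alpha>. (\<Sum>j=1..p. \<alpha> j * x j) + (\<Sum>k=1..d. z k * (MAX j\<in>{1..p}. w k j - \<alpha> j)))
          (rvec p)
          (Transport p d x z w))
     \<and>
     (\<forall>(\<tau>::nat) (p :: nat \<Rightarrow> nat) (d::nat) (w :: nat \<Rightarrow> nat \<Rightarrow> nat \<Rightarrow> real) (b :: nat \<Rightarrow> real)
        (f :: nat \<Rightarrow> (nat \<Rightarrow> nat \<Rightarrow> real) \<Rightarrow> real).
        d \<ge> 1 \<longrightarrow> (\<forall>i\<in>{1..\<tau>}. p i \<ge> 1) \<longrightarrow> (\<forall>k\<in>{1..d}. w k \<in> block_vec \<tau> p) \<longrightarrow>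
        (\<forall>k\<in>{1..d}. \<forall>x\<in>simplex_prod \<tau> p.
           f k x = (\<Sum>i=1..\<tau>. \<Sum>j=1..p i. w k i j * x i j) + b k) \<longrightarrow>
        {(x, y, z). x \<in> simplex_prod \<tau> p \<and> z \<in> prob_simplex d \<and>
           (\<forall>\<alpha>\<in>block_vec \<tau> p.
              y \<le> block_dot \<tau> p \<alpha> x +
                (\<Sum>k=1..d.
                   (max_over (block_dot \<tau> p (\<lambda>i j. w k i j - \<alpha> i j)) (simplex_prod \<tau> p) + b k)
                     * z k)) \<and>
           (\<forall>k\<in>{1..d}. y \<ge> f k x)}
        =
        {(x, y, z). x \<in> simplex_prod \<tau> p \<and> z \<in> prob_simplex d \<and>
           y \<le> (\<Sum>i=1..\<tau>. Transport (p i) d (x i) z (\<lambda>k. w k i)) + (\<Sum>k=1..d. b k * z k) \<and>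
           (\<forall>k\<in>{1..d}. y \<ge> f k x)})"
proof (rule conjI, goal_cases)
  case 1
  show ?case by (intro allI impI) (rule transport_strong_duality)
next
  case 2
  show ?case
    \<comment> \<open>Both sets share the lower bounds on \<open>y\<close>, so only the upper bounds
      are compared; \<open>conj_cong\<close> supplies the memberships of \<open>x\<close> and
      \<open>z\<close> that the rewriting needs.\<close>
    by (intro allI impI Collect_cong) (clarsimp simp only: prod.case upper_bounds_iff_Transport split: prod.splits cong: conj_cong)
qed

end
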